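(* Let $n,m\in\mathbf N$, let $S\subset \mathbf K^m$ be a subset and let $f:S\to \mathbf K^n$ be a lipschitzian function with constants $0<\mathrm{Lip}_1(f):=C<\infty$ and $0<\mathrm{Lip}_2(f):=r\le 1$, that is, $|f(x)-f(y)|\le C|x-y|^r$ for all $x,y\in S$. Then $f$ has a lipschitzian extension $g:\mathbf K^m\to\mathbf K^n$ (so $g|_S=f$) such that $\mathrm{Lip}_1(g)=\mathrm{Lip}_1(f)$ and $\mathrm{Lip}_2(g)=\mathrm{Lip}_2(f)$, i.e. $|g(x)-g(y)|\le C|x-y|^r$ for all $x,y\in\mathbf K^m$.
   Context: $\mathbf K$ is an infinite locally compact field with a non-trivial non-archimedean multiplicative norm $|\cdot|$ (normalized as the modular function $|x|=\mathrm{mod}_{\mathbf K}(x)$). On $\mathbf K^m$ the norm is $|x|=\max_{1\le j\le m}|x_j|$. A function is called lipschitzian with constants $\mathrm{Lip}_1=C$ and $\mathrm{Lip}_2=r$ if it satisfies the displayed inequality with these constants on its domain. *)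

theory Defs
  imports "HOL-Analysis.Analysis"
begin

text \<open>
  The library's \<^const>\<open>norm\<close> is restricted to real normed vector spaces and thus never
  non-archimedean, hence a separate norm.  Its metric induces the topology of the field.
\<close>

class nonarch_normed_field = field + metric_space +
  fixes na_norm :: "'a \<Rightarrow> real"
  assumes na_norm_nonneg: "0 \<le> na_norm x"
    and na_norm_eq_zero: "na_norm x = 0 \<longleftrightarrow> x = 0"
    and na_norm_mult: "na_norm (x * y) = na_norm x * na_norm y"
    and na_norm_add: "na_norm (x + y) \<le> max (na_norm x) (na_norm y)"
    and na_dist_norm: "dist x y = na_norm (x - y)"

definition haar_measure :: "'a::{topological_space, ab_group_add} measure \<Rightarrow> bool" where
  "haar_measure M \<longleftrightarrow>
     sets M = sets borel \<and>
     emeasure M UNIV \<noteq> 0 \<and>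
     (\<forall>K. compact K \<longrightarrow> emeasure M K < \<infinity>) \<and>
     (\<forall>A\<in>sets borel. emeasure M A = (INF U\<in>{U. open U \<and> A \<subseteq> U}. emeasure M U)) \<and>
     (\<forall>U. open U \<longrightarrow> emeasure M U = (SUP K\<in>{K. compact K \<and> K \<subseteq> U}. emeasure M K)) \<and>
     (\<forall>a. \<forall>A\<in>sets borel. emeasure M ((+) a ` A) = emeasure M A)"

text \<open>
  The modular function of a locally compact field: multiplication by \<open>a \<noteq> 0\<close> scales every
  Haar measure by the factor \<open>modular_function a\<close>, and the value at \<open>0\<close> is \<open>0\<close>.
  Existence and uniqueness of the factor is Haar's theorem.  The condition \<open>0 < c\<close> is needed
  because \<^const>\<open>ennreal\<close> sends all negative reals to \<open>0\<close>.
\<close>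

definition modular_function :: "'a::{topological_space, field} \<Rightarrow> real" where
  "modular_function a =
     (if a = 0 then 0
      else THE c. 0 < c \<and>
        (\<forall>M. haar_measure M \<longrightarrow>
          (\<forall>A\<in>sets borel. emeasure M ((*) a ` A) = ennreal c * emeasure M A)))"

text \<open>The library's distance on \<^typ>\<open>'a ^ 'm\<close> is Euclidean, hence a separate maximum norm.\<close>

definition max_norm :: "'a::nonarch_normed_field ^ 'm \<Rightarrow> real" where
  "max_norm x = Max (range (\<lambda>j. na_norm (x $ j)))"

definition lipschitzian_on ::
    "real \<Rightarrow> real \<Rightarrow> ('a::nonarch_normed_field ^ 'm) set \<Rightarrow> ('a ^ 'm \<Rightarrow> 'a ^ 'n) \<Rightarrow> bool" where
  "lipschitzian_on C r S f \<longleftrightarrow>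
     (\<forall>x\<in>S. \<forall>y\<in>S. max_norm (f x - f y) \<le> C * max_norm (x - y) powr r)"

end

theory Submission imports Defs begin

text \<open>
  The admissible values at a point \<open>z\<close> form the set \<open>A z\<close> of all \<open>w\<close> with
  \<open>\<bar>w - f x\<bar> \<le> C \<bar>x - z\<bar>\<^sup>r\<close> for all \<open>x \<in> S\<close>.  Closed balls of the field are compact, so coordinatewise
  the finite intersection property gives \<open>A z \<noteq> {}\<close>.  No transfinite
  extension is needed: any choice \<open>g z \<in> A z\<close> that depends only on the set \<open>A z\<close> works.  Indeed, if
  some \<open>x \<in> S\<close> satisfies \<open>\<bar>x - z\<bar> \<le> \<bar>z - y\<bar>\<close>, then \<open>\<bar>x - y\<bar> \<le> \<bar>z - y\<bar>\<close> too, and comparing \<open>g z\<close> and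
  \<open>g y\<close> with \<open>f x\<close> gives the estimate; otherwise \<open>\<bar>x - z\<bar> = \<bar>x - y\<bar>\<close> for all \<open>x \<in> S\<close>, so
  \<open>A z = A y\<close> and \<open>g z = g y\<close>.
\<close>

lemma na_norm_one [simp]: "na_norm (1 :: 'k::nonarch_normed_field) = 1"
  using na_norm_mult[of "1::'k" 1] na_norm_eq_zero[of "1::'k"] by simp

lemma na_norm_zero [simp]: "na_norm 0 = 0"
  by (simp add: na_norm_eq_zero)

lemma na_norm_minus_commute: "na_norm (x - y) = na_norm (y - x)"
  by (metis na_dist_norm dist_commute)

lemma na_norm_power: "na_norm (x ^ n) = na_norm x ^ n"
  by (induction n) (simp_all add: na_norm_mult)

lemma na_norm_inverse:
  assumes "x \<noteq> 0"
  shows "na_norm (inverse x) = inverse (na_norm x)"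
  using na_norm_mult[of x "inverse x"] assms by (simp add: inverse_unique)

lemma exists_na_norm_gt_one:
  fixes a :: "'k::nonarch_normed_field"
  assumes "a \<noteq> 0" "na_norm a \<noteq> 1"
  obtains b :: 'k where "1 < na_norm b"
proof (cases "1 < na_norm a")
  case False
  then have "na_norm a < 1" "0 < na_norm a"
    using assms na_norm_nonneg[of a] na_norm_eq_zero[of a] by linarith+
  then have "1 < na_norm (inverse a)"
    using assms(1) by (simp add: na_norm_inverse one_less_inverse)
  then show ?thesis by (rule that)
qed (rule that)

text \<open>Some ball around \<open>0\<close> lies in a compact neighbourhood. Multiplying by a high
  power of an element of norm above \<open>1\<close> and translating is a similarity, so the image
  of that neighbourhood is compact and covers any prescribed ball.\<close>

lemma compact_cball_of_locally_compact:
  fixes x :: "'k::nonarch_normed_field"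
  assumes lc: "locally_compact_space (euclidean :: 'k topology)"
    and nontrivial: "\<exists>a::'k. a \<noteq> 0 \<and> na_norm a \<noteq> 1"
  shows "compact (cball x R)"
proof -
  obtain U K where UK: "open U" "compact K" "(0::'k) \<in> U" "U \<subseteq> K"
    using lc unfolding locally_compact_space_def by simp metis
  then obtain e where e: "0 < e" "cball 0 e \<subseteq> U"
    using open_contains_cball by blast
  obtain a :: 'k where a: "1 < na_norm a"
    using nontrivial exists_na_norm_gt_one by blast
  \<comment> \<open>The factor \<open>na_norm a ^ n\<close> enlarges the radius \<open>e\<close> to
    more than \<open>R\<close>.\<close>
  obtain n where n: "R / e < na_norm a ^ n"
    using a real_arch_pow by blast
  define h where "h y = x + a ^ n * y" for y
  have dist_h: "dist (h y) (h z) = na_norm a ^ n * dist y z" for y z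
    unfolding h_def na_dist_norm
    by (simp add: na_norm_mult na_norm_power flip: right_diff_distrib)
  have "continuous_on K h"
    by (rule lipschitz_on_continuous_on[of "na_norm a ^ n"])
      (auto simp: lipschitz_on_def dist_h na_norm_nonneg)
  then have "compact (h ` K)"
    using UK(2) compact_continuous_image by blast
  moreover have "cball x R \<subseteq> h ` K"
  proof
    fix y assume y: "y \<in> cball x R"
    define z where "z = (y - x) / a ^ n"
    have "a \<noteq> 0" using a na_norm_eq_zero[of a] by auto
    then have hz: "h z = y" by (simp add: h_def z_def)
    have "na_norm a ^ n * dist 0 z = dist x y"
      using dist_h[of 0 z] hz by (simp add: h_def)
    also have "\<dots> \<le> R" using y by simp
    also have "\<dots> \<le> na_norm a ^ n * e"
      using n e(1) by (simp add: field_simps)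
    finally have "dist 0 z \<le> e" using a by simp
    then have "z \<in> K" using e(2) UK(4) by auto
    then show "y \<in> h ` K" using hz by blast
  qed
  ultimately show ?thesis
    using compact_Int_closed[of "h ` K" "cball x R"] by (simp add: Int_absorb1)
qed

text \<open>The hypothesis \<open>near\<close> is what the ultrametric inequality yields for balls
  that meet pairwise: the centre of the smaller ball lies in the larger one. Compactness then
  reduces the claim to finite subfamilies.\<close>

lemma cball_family_common_point:
  fixes c :: "'i \<Rightarrow> 'a::metric_space"
  assumes comp: "\<And>x R. compact (cball x R :: 'a set)"
    and near: "\<And>i j. i \<in> I \<Longrightarrow> j \<in> I \<Longrightarrow> dist (c i) (c j) \<le> max (\<rho> i) (\<rho> j)"
  shows "\<exists>w. \<forall>i\<in>I. dist (c i) w \<le> \<rho> i"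
proof (cases "I = {}")
  case False
  then obtain k where k: "k \<in> I" by blast
  \<comment> \<open>The ball at \<open>k\<close> serves as the ambient compact set; the other balls
    enter as closed sets.\<close>
  have "cball (c k) (\<rho> k) \<inter> (\<Inter>i\<in>I. cball (c i) (\<rho> i)) \<noteq> {}"
  proof (rule compact_imp_fip_image[OF comp])
    fix J assume J: "finite J" "J \<subseteq> I"
    define J' where "J' = insert k J"
    \<comment> \<open>The centre of a ball of least radius lies in all the others.\<close>
    have J': "finite J'" "J' \<noteq> {}" "J' \<subseteq> I" using J k by (auto simp: J'_def)
    obtain j where j: "j \<in> J'" and least: "\<And>i. i \<in> J' \<Longrightarrow> \<rho> j \<le> \<rho> i"
      using J' by (metis arg_min_if_finite(1) arg_min_least)
    have "dist (c i) (c j) \<le> \<rho> i" if "i \<in> J'" for i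
      using near[of i j] least[OF that] j that J'(3) by auto
    then have "c j \<in> cball (c k) (\<rho> k) \<inter> (\<Inter>i\<in>J. cball (c i) (\<rho> i))"
      by (auto simp: J'_def)
    then show "cball (c k) (\<rho> k) \<inter> (\<Inter>i\<in>J. cball (c i) (\<rho> i)) \<noteq> {}" by blast
  qed simp
  then show ?thesis by fastforce
qed simp

lemma max_norm_le_iff: "max_norm x \<le> b \<longleftrightarrow> (\<forall>j. na_norm (x $ j) \<le> b)"
  by (auto simp: max_norm_def)

lemma na_norm_nth_le: "na_norm (x $ j) \<le> max_norm x"
  using max_norm_le_iff by blast

lemma max_norm_nonneg: "0 \<le> max_norm x"
  using na_norm_nonneg na_norm_nth_le order_trans by blast

lemma max_norm_minus_commute: "max_norm (x - y) = max_norm (y - x)"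
  unfolding max_norm_def by (simp add: na_norm_minus_commute)

lemma max_norm_zero [simp]: "max_norm 0 = 0"
  by (simp add: max_norm_def)

lemma max_norm_le_zero_iff: "max_norm x \<le> 0 \<longleftrightarrow> x = 0"
  by (auto simp: max_norm_le_iff vec_eq_iff antisym na_norm_nonneg simp flip: na_norm_eq_zero)

lemma max_norm_add: "max_norm (x + y) \<le> max (max_norm x) (max_norm y)"
  unfolding max_norm_le_iff
proof
  fix j
  have "na_norm ((x + y) $ j) \<le> max (na_norm (x $ j)) (na_norm (y $ j))"
    by (simp add: na_norm_add)
  also have "\<dots> \<le> max (max_norm x) (max_norm y)"
    by (intro max.mono na_norm_nth_le)
  finally show "na_norm ((x + y) $ j) \<le> max (max_norm x) (max_norm y)" .
qed

lemma max_norm_triangle: "max_norm (x - z) \<le> max (max_norm (x - y)) (max_norm (y - z))"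
  using max_norm_add[of "x - y" "y - z"] by simp

lemma max_norm_isosceles:
  assumes "max_norm (y - z) < max_norm (x - z)"
  shows "max_norm (x - y) = max_norm (x - z)"
proof (rule antisym)
  show "max_norm (x - y) \<le> max_norm (x - z)"
    using max_norm_triangle[of x y z] assms by (simp add: max_norm_minus_commute[of z y])
  show "max_norm (x - z) \<le> max_norm (x - y)"
    using max_norm_triangle[of x z y] assms by simp
qed

definition admissible_values ::
    "real \<Rightarrow> real \<Rightarrow> ('k::nonarch_normed_field ^ 'm) set \<Rightarrow> ('k ^ 'm \<Rightarrow> 'k ^ 'n) \<Rightarrow>
      'k ^ 'm \<Rightarrow> ('k ^ 'n) set" where
  "admissible_values C r S f z =
     {w. \<forall>x\<in>S. max_norm (f x - w) \<le> C * max_norm (x - z) powr r}"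

text \<open>The ultrametric inequality through \<open>z\<close>, with monotonicity of
  \<open>t powr r\<close>, turns the Lipschitz bound into the condition \<open>near\<close>. A ball
  of \<open>max_norm\<close> is a product of balls of the field, so a common point is found in each
  coordinate separately.\<close>

lemma admissible_values_nonempty:
  fixes S :: "('k::nonarch_normed_field ^ 'm) set" and f :: "'k ^ 'm \<Rightarrow> 'k ^ 'n"
  assumes comp: "\<And>x R. compact (cball x R :: 'k set)"
    and "0 \<le> C" "0 \<le> r" and lip: "lipschitzian_on C r S f"
  shows "admissible_values C r S f z \<noteq> {}"
proof -
  define \<rho> where "\<rho> x = C * max_norm (x - z) powr r" for x
  have mono: "C * s powr r \<le> C * t powr r" if "0 \<le> s" "s \<le> t" for s t
    using that assms(2,3) by (intro mult_left_mono powr_mono2) auto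
  have near: "max_norm (f x - f y) \<le> max (\<rho> x) (\<rho> y)" if "x \<in> S" "y \<in> S" for x y
  proof -
    have "max_norm (f x - f y) \<le> C * max_norm (x - y) powr r"
      using lip that by (simp add: lipschitzian_on_def)
    also have "\<dots> \<le> C * max (max_norm (x - z)) (max_norm (y - z)) powr r"
      using max_norm_triangle[of x y z]
      by (intro mono max_norm_nonneg) (simp add: max_norm_minus_commute[of z y])
    also have "\<dots> \<le> max (\<rho> x) (\<rho> y)"
      by (simp add: \<rho>_def max_def)
    finally show ?thesis .
  qed
  have "\<exists>w. \<forall>x\<in>S. dist (f x $ i) w \<le> \<rho> x" for i
  proof (rule cball_family_common_point[OF comp])
    fix x y assume "x \<in> S" "y \<in> S"
    then show "dist (f x $ i) (f y $ i) \<le> max (\<rho> x) (\<rho> y)"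
      using near[of x y] na_norm_nth_le[of "f x - f y" i] by (simp add: na_dist_norm)
  qed
  then obtain w where w: "\<And>i x. x \<in> S \<Longrightarrow> dist (f x $ i) (w i) \<le> \<rho> x"
    by metis
  then have "(\<chi> i. w i) \<in> admissible_values C r S f z"
    by (simp add: admissible_values_def max_norm_le_iff na_dist_norm \<rho>_def)
  then show ?thesis by blast
qed

theorem mainTheorem1:
  fixes S :: "('k::nonarch_normed_field ^ 'm) set"
    and f :: "'k ^ 'm \<Rightarrow> 'k ^ 'n"
    and C r :: real
  assumes "infinite (UNIV :: 'k set)"
    and "locally_compact_space (euclidean :: 'k topology)"
    and "\<exists>a::'k. a \<noteq> 0 \<and> na_norm a \<noteq> 1"
    and "\<And>a::'k. na_norm a = modular_function a"
    and "0 < C" and "0 < r" and "r \<le> 1"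
    and "lipschitzian_on C r S f"
  shows "\<exists>g :: 'k ^ 'm \<Rightarrow> 'k ^ 'n.
           (\<forall>x\<in>S. g x = f x) \<and> lipschitzian_on C r UNIV g"
proof -
  let ?A = "admissible_values C r S f"
  define g where "g z = (SOME w. w \<in> ?A z)" for z
  have "compact (cball x R)" for x :: 'k and R
    using assms(2,3) by (rule compact_cball_of_locally_compact)
  then have "?A z \<noteq> {}" for z
    using assms(5,6,8) by (intro admissible_values_nonempty) auto
  then have g: "g z \<in> ?A z" for z
    unfolding g_def by (simp add: some_in_eq)
  then have g_near: "max_norm (f x - g z) \<le> C * max_norm (x - z) powr r" if "x \<in> S" for x z
    using that by (auto simp: admissible_values_def)
  have "g x = f x" if "x \<in> S" for x
    \<comment> \<open>For \<open>z = x\<close> the bound is \<open>C * 0 powr r\<close>, which is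
      \<open>0\<close>.\<close>
    using g_near[OF that, of x] by (simp add: max_norm_le_zero_iff)
  moreover have "max_norm (g z - g y) \<le> C * max_norm (z - y) powr r" for z y
  proof (cases "\<exists>x\<in>S. max_norm (x - z) \<le> max_norm (z - y)")
    case True
    then obtain x where x: "x \<in> S" "max_norm (x - z) \<le> max_norm (z - y)" by blast
    then have "max_norm (x - y) \<le> max_norm (z - y)"
      using max_norm_triangle[of x y z] by simp
    then have bound: "max_norm (f x - g v) \<le> C * max_norm (z - y) powr r"
      if "v = z \<or> v = y" for v
      using that x(2) assms(5,6)
      by (intro order_trans[OF g_near[OF x(1)]] mult_left_mono powr_mono2)
        (auto simp: max_norm_nonneg)
    show ?thesis
      \<comment> \<open>Passing through \<open>f x\<close> costs a maximum instead of a sum, so the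
        constant \<open>C\<close> does not grow.\<close>
      using max_norm_triangle[of "g z" "g y" "f x"] bound[of z] bound[of y]
      by (simp add: max_norm_minus_commute[of "g z" "f x"])
  next
    case False
    \<comment> \<open>Here \<open>z\<close> and \<open>y\<close> are closer to each other than
      \<open>z\<close> is to any point of \<open>S\<close>, so the two longer sides of the triangle
      \<open>x\<close>, \<open>y\<close>, \<open>z\<close> are equal.\<close>
    then have "max_norm (x - y) = max_norm (x - z)" if "x \<in> S" for x
      using that
      by (intro max_norm_isosceles) (auto simp: max_norm_minus_commute[of y z] not_le)
    then have "?A z = ?A y" by (simp add: admissible_values_def)
    then have "g z = g y" by (simp add: g_def)
    then show ?thesis using assms(5) by simp
  qed
  ultimately show ?thesis
    unfolding lipschitzian_on_def by blast
qed

end
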